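(* Assume that there exists a Luzin set. Then there exists a nonmetrizable Eberlein compact space $K$ without closed nonmetrizable zero-dimensional subspaces, i.e., no closed subspace of $K$ is both nonmetrizable and zero-dimensional.
   Context: A Luzin set is an uncountable subset $L$ of the real line $\mathbb{R}$ such that, for every meager subset $A$ of $\mathbb{R}$, the intersection $A\cap L$ is countable. A compact (Hausdorff) space $K$ is Eberlein compact if it is homeomorphic to a weakly compact subset of a Banach space; equivalently, if it embeds, for some set $\Gamma$, into the subspace $c_0(\Gamma)=\{x\in\mathbb{R}^\Gamma:\text{ for every }\varepsilon>0\text{ the set }\{\gamma:|x(\gamma)|>\varepsilon\}\text{ is finite}\}$ of the product $\mathbb{R}^\Gamma$. *)

theory Defs
  imports "HOL-Analysis.Analysis"
begin

definition nowhere_dense :: "'a::topological_space set \<Rightarrow> bool" where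
  "nowhere_dense A \<longleftrightarrow> interior (closure A) = {}"

definition meager :: "'a::topological_space set \<Rightarrow> bool" where
  "meager A \<longleftrightarrow> (\<exists>F :: nat \<Rightarrow> 'a set. (\<forall>n. nowhere_dense (F n)) \<and> A = (\<Union>n. F n))"

definition luzin_set :: "real set \<Rightarrow> bool" where
  "luzin_set L \<longleftrightarrow> uncountable L \<and> (\<forall>A. meager A \<longrightarrow> countable (A \<inter> L))"

text \<open>Points of \<open>\<real>\<^sup>\<Gamma>\<close> are represented, as in the library's product topology, by functions
  that are \<open>undefined\<close> outside the index set.\<close>

definition c0 :: "'g set \<Rightarrow> ('g \<Rightarrow> real) set" where
  "c0 \<Gamma> = {x \<in> (\<Pi>\<^sub>E \<gamma>\<in>\<Gamma>. UNIV). \<forall>\<epsilon>>0. finite {\<gamma>\<in>\<Gamma>. \<bar>x \<gamma>\<bar> > \<epsilon>}}"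

text \<open>HOL cannot quantify over the type of the index set \<open>\<Gamma>\<close> inside a definition. Index sets of
  functions on the space itself suffice: an embedding indexed by a set of any type can be
  re-indexed by its own coordinate functions, see \<open>eberlein_compact_spaceI\<close> below.\<close>

definition eberlein_compact_space :: "'a topology \<Rightarrow> bool" where
  "eberlein_compact_space X \<longleftrightarrow>
     compact_space X \<and> Hausdorff_space X \<and>
     (\<exists>(\<Gamma> :: ('a \<Rightarrow> real) set) e. embedding_map X (subtopology (powertop_real \<Gamma>) (c0 \<Gamma>)) e)"

lemma eberlein_compact_spaceI:
  fixes X :: "'a topology" and \<Gamma> :: "'g set"
  assumes comp: "compact_space X"
    and emb: "embedding_map X (subtopology (powertop_real \<Gamma>) (c0 \<Gamma>)) e"
  shows "eberlein_compact_space X"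
proof -
  define h where "h = (\<lambda>\<gamma> x. if x \<in> topspace X then e x \<gamma> else 0)"
  define \<Delta> where "\<Delta> = h ` \<Gamma>"
  define e' where "e' = (\<lambda>x. restrict (\<lambda>\<delta>. \<delta> x) \<Delta>)"
  have ce: "continuous_map X (subtopology (powertop_real \<Gamma>) (c0 \<Gamma>)) e"
    and inje: "inj_on e (topspace X)"
    using emb by (auto simp: embedding_map_def homeomorphic_eq_everything_map
        continuous_map_in_subtopology)
  have cep: "continuous_map X (powertop_real \<Gamma>) e" and ec0: "\<And>x. x \<in> topspace X \<Longrightarrow> e x \<in> c0 \<Gamma>"
    using ce by (auto simp: continuous_map_in_subtopology)
  have haus: "Hausdorff_space (powertop_real \<Gamma>)" "Hausdorff_space (powertop_real \<Delta>)"
    by (simp_all add: Hausdorff_space_product_topology)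
  have hX: "Hausdorff_space X"
    using emb haus embedding_map_imp_homeomorphic_space homeomorphic_Hausdorff_space
      Hausdorff_space_subtopology by metis
  have "continuous_map X (powertop_real \<Delta>) e'"
    unfolding continuous_map_componentwise
  proof (intro conjI ballI)
    show "e' ` topspace X \<subseteq> extensional \<Delta>"
      by (auto simp: e'_def)
    fix \<delta> assume d: "\<delta> \<in> \<Delta>"
    then obtain \<gamma> where g: "\<gamma> \<in> \<Gamma>" "\<delta> = h \<gamma>" by (auto simp: \<Delta>_def)
    have "continuous_map X euclideanreal (\<lambda>x. e x \<gamma>)"
      using cep g by (simp add: continuous_map_componentwise)
    then show "continuous_map X euclideanreal (\<lambda>x. e' x \<delta>)"
      by (rule continuous_map_eq) (use g d in \<open>auto simp: e'_def h_def\<close>)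
  qed
  moreover have "e' x \<in> c0 \<Delta>" if x: "x \<in> topspace X" for x
  proof -
    have "finite {\<delta>\<in>\<Delta>. \<bar>e' x \<delta>\<bar> > \<epsilon>}" if "\<epsilon> > 0" for \<epsilon> :: real
    proof -
      have "finite {\<gamma>\<in>\<Gamma>. \<bar>e x \<gamma>\<bar> > \<epsilon>}"
        using ec0[OF x] that by (simp add: c0_def)
      moreover have "{\<delta>\<in>\<Delta>. \<bar>e' x \<delta>\<bar> > \<epsilon>} \<subseteq> h ` {\<gamma>\<in>\<Gamma>. \<bar>e x \<gamma>\<bar> > \<epsilon>}"
        using x by (auto simp: e'_def \<Delta>_def h_def)
      ultimately show ?thesis using finite_surj by blast
    qed
    then show ?thesis by (simp add: c0_def e'_def)
  qed
  ultimately have ce': "continuous_map X (subtopology (powertop_real \<Delta>) (c0 \<Delta>)) e'"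
    by (auto simp: continuous_map_in_subtopology)
  have inj': "inj_on e' (topspace X)"
  proof (rule inj_onI)
    fix x y assume xy: "x \<in> topspace X" "y \<in> topspace X" and eq: "e' x = e' y"
    have "e x \<gamma> = e y \<gamma>" if "\<gamma> \<in> \<Gamma>" for \<gamma>
      using fun_cong[OF eq, of "h \<gamma>"] that xy by (simp add: e'_def \<Delta>_def h_def)
    moreover have "e x \<in> extensional \<Gamma>" "e y \<in> extensional \<Gamma>"
      using ec0 xy by (auto simp: c0_def PiE_def)
    ultimately have "e x = e y" by (metis extensionalityI)
    then show "x = y" using inje xy by (meson inj_onD)
  qed
  have "embedding_map X (subtopology (powertop_real \<Delta>) (c0 \<Delta>)) e'"
    using ce' inj' comp haus
    by (intro injective_closed_imp_embedding_map continuous_imp_closed_map)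
       (auto simp: Hausdorff_space_subtopology)
  then show ?thesis
    unfolding eberlein_compact_space_def using comp hX by blast
qed

definition zero_dimensional_space :: "'a topology \<Rightarrow> bool" where
  "zero_dimensional_space X \<longleftrightarrow>
     (\<exists>\<B>. (\<forall>B\<in>\<B>. openin X B \<and> closedin X B) \<and>
          (\<forall>U. openin X U \<longrightarrow> (\<exists>\<U>\<subseteq>\<B>. U = \<Union>\<U>)))"

lemma zero_dimensional_space_iff_dimension_le_0:
  "zero_dimensional_space X \<longleftrightarrow> X dim_le 0"
proof
  assume "zero_dimensional_space X"
  then obtain \<B> where B: "\<And>B. B \<in> \<B> \<Longrightarrow> openin X B \<and> closedin X B"
    and base: "\<And>U. openin X U \<Longrightarrow> \<exists>\<U>\<subseteq>\<B>. U = \<Union>\<U>"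
    unfolding zero_dimensional_space_def by auto
  show "X dim_le 0"
    unfolding dimension_le_0_neighbourhood_base_of_clopen neighbourhood_base_of
  proof (intro allI impI)
    fix W x assume W: "openin X W \<and> x \<in> W"
    then obtain \<U> where "\<U> \<subseteq> \<B>" "W = \<Union>\<U>" using base by blast
    with W obtain V where "V \<in> \<B>" "x \<in> V" "V \<subseteq> W" by auto
    then show "\<exists>U V. openin X U \<and> (closedin X V \<and> openin X V) \<and> x \<in> U \<and> U \<subseteq> V \<and> V \<subseteq> W"
      using B by blast
  qed
next
  assume "X dim_le 0"
  then have nb0: "neighbourhood_base_of (\<lambda>U. closedin X U \<and> openin X U) X"
    by (simp add: dimension_le_0_neighbourhood_base_of_clopen)
  have nb: "\<exists>V. openin X V \<and> closedin X V \<and> x \<in> V \<and> V \<subseteq> U" if "openin X U" "x \<in> U" for U x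
  proof -
    have "\<exists>U' V. openin X U' \<and> (closedin X V \<and> openin X V) \<and> x \<in> U' \<and> U' \<subseteq> V \<and> V \<subseteq> U"
      using nb0 that unfolding neighbourhood_base_of by simp
    then show ?thesis by blast
  qed
  show "zero_dimensional_space X"
    unfolding zero_dimensional_space_def
  proof (rule exI[of _ "{B. openin X B \<and> closedin X B}"], intro conjI allI impI)
    fix U assume U: "openin X U"
    have "U = \<Union>{B. openin X B \<and> closedin X B \<and> B \<subseteq> U}"
    proof (intro equalityI subsetI)
      fix x assume "x \<in> U"
      with nb[OF U] show "x \<in> \<Union>{B. openin X B \<and> closedin X B \<and> B \<subseteq> U}" by (simp, blast)
    qed auto
    moreover have "{B. openin X B \<and> closedin X B \<and> B \<subseteq> U} \<subseteq> {B. openin X B \<and> closedin X B}"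
      by blast
    ultimately show "\<exists>\<U>\<subseteq>{B. openin X B \<and> closedin X B}. U = \<Union>\<U>"
      by blast
  qed auto
qed

end

theory Submission
  imports Defs
begin

text \<open>
  The space is the Alexandroff duplicate of an interval in which only the points of an
  uncountable part \<open>B\<close> of a Luzin set are doubled: each \<open>x\<close> in the interval gives a base point,
  each \<open>l \<in> B\<close> gives in addition an isolated twin, and any injective sequence of twins whose
  parameters converge to \<open>x\<close> converges to the base point of \<open>x\<close>. Adjoining to the parameter the
  indicator function of the doubled point (zero for base points) realises this space inside
  \<open>c0\<close>, so it is Eberlein compact.

  Countability of the set of twins in a closed subspace decides metrizability. If there are only
  countably many, countably many coordinates separate the points (\<open>metrizable_if_few_twins\<close>).
  The whole space, having uncountably many twins, is not metrizable: the base interval would be a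
  \<open>G\<^sub>\<delta>\<close>, so some closed set disjoint from it would contain infinitely many twins, which accumulate
  at a base point (\<open>not_metrizable_duplicate\<close>).

  Now let a closed subspace \<open>F\<close> be nonmetrizable. The parameters of its twins form an uncountable
  subset of a Luzin set, hence a set which is dense in some open interval. The corresponding base
  points are limits of twins (\<open>base_mem_if_limit_of_twins\<close>), so \<open>F\<close> contains a copy of a
  nondegenerate interval and cannot be zero-dimensional.
\<close>

section \<open>Somewhere density of uncountable parts of a Luzin set\<close>

lemma luzin_set_bounded_part:
  assumes "luzin_set L"
  obtains a b where "uncountable (L \<inter> {a..b})"
proof -
  have "\<exists>n::nat. uncountable (L \<inter> {- real n..real n})"
  proof (rule ccontr)
    assume "\<not> ?thesis"
    then have "countable (\<Union>n::nat. L \<inter> {- real n..real n})"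
      by blast
    moreover have "L \<subseteq> (\<Union>n::nat. L \<inter> {- real n..real n})"
    proof
      fix x assume "x \<in> L"
      moreover obtain n :: nat where "\<bar>x\<bar> \<le> real n"
        using real_arch_simple by blast
      ultimately have "x \<in> L \<inter> {- real n..real n}"
        by auto
      then show "x \<in> (\<Union>n::nat. L \<inter> {- real n..real n})"
        by blast
    qed
    ultimately have "countable L"
      by (rule countable_subset[rotated])
    then show False
      using assms by (simp add: luzin_set_def)
  qed
  then show thesis using that by blast
qed

text \<open>A nowhere dense set is meager, so it meets the Luzin set in a countable set only. Points of an
  open set contained in the closure are limit points because the line has no isolated points.\<close>

lemma luzin_set_uncountable_subset_limpt:
  assumes L: "luzin_set L" and A: "A \<subseteq> L" "uncountable A"
  obtains u v where "u < v" "\<And>x. x \<in> {u..v} \<Longrightarrow> x islimpt A"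
proof -
  have "\<not> nowhere_dense A"
  proof
    assume "nowhere_dense A"
    then have "meager A"
      unfolding meager_def by (intro exI[of _ "\<lambda>_. A"]) auto
    then have "countable (A \<inter> L)"
      using L by (auto simp: luzin_set_def)
    then show False using A by (simp add: Int_absorb2)
  qed
  then obtain y where y: "y \<in> interior (closure A)"
    by (auto simp: nowhere_dense_def)
  then obtain e where e: "e > 0" "cball y e \<subseteq> interior (closure A)"
    using open_contains_cball open_interior by metis
  show thesis
  proof (rule that[of y "y + e"])
    show "y < y + e" using e by simp
    fix x assume "x \<in> {y..y+e}"
    then have "x \<in> interior (closure A)"
      using e by (auto simp: cball_def dist_real_def subset_iff)
    then have "x islimpt closure A"
      by (rule interior_limit_point)
    then show "x islimpt A"
      by (simp add: limpt_of_closure)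
  qed
qed

section \<open>The partial Alexandroff duplicate of an interval\<close>

text \<open>The coordinate \<open>c\<close> carries the position in the interval, and the coordinate \<open>l \<in> B\<close> says
  whether the point is the twin of \<open>l\<close>. Requiring that the flag \<open>l\<close> is set only at position \<open>l\<close>
  already forces at most one flag to be set, and it is a closed condition in the product.\<close>

locale duplicate =
  fixes a b c :: real and B :: "real set"
  assumes B_subset: "B \<subseteq> {a..b}" and c_notin: "c \<notin> B"
begin

definition index :: "real set" where
  "index = insert c B"

definition points :: "(real \<Rightarrow> real) set" where
  "points = {z \<in> (\<Pi>\<^sub>E i\<in>index. if i = c then {a..b} else {0, 1}). \<forall>l\<in>B. z l = 0 \<or> z c = l}"

definition K :: "(real \<Rightarrow> real) topology" where
  "K = subtopology (powertop_real index) points"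

definition base :: "real \<Rightarrow> real \<Rightarrow> real" where
  "base x = (\<lambda>i\<in>index. if i = c then x else 0)"

definition twin :: "real \<Rightarrow> real \<Rightarrow> real" where
  "twin x = (\<lambda>i\<in>index. if i = c then x else if i = x then 1 else 0)"

lemma topspace_K [simp]: "topspace K = points"
  by (auto simp: K_def points_def)

lemma base_in_points: "x \<in> {a..b} \<Longrightarrow> base x \<in> points"
  using c_notin by (auto simp: points_def base_def index_def)

lemma twin_in_points: "l \<in> B \<Longrightarrow> twin l \<in> points"
  using c_notin B_subset by (auto simp: points_def twin_def index_def)

lemma base_at_c [simp]: "base x c = x"
  by (simp add: base_def index_def)

lemma twin_at_c [simp]: "twin x c = x"
  by (simp add: twin_def index_def)

lemma base_flag: "l \<in> B \<Longrightarrow> base x l = 0"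
  using c_notin by (auto simp: base_def index_def)

lemma twin_flag: "l \<in> B \<Longrightarrow> twin l l = 1"
  using c_notin by (auto simp: twin_def index_def)

lemma limpt_in_interval:
  assumes "x islimpt T" "T \<subseteq> B"
  shows "x \<in> {a..b}"
proof -
  have "x islimpt {a..b}"
    using assms B_subset by (meson islimpt_subset subset_trans)
  then show ?thesis
    by (metis closed_limpt closed_real_atLeastAtMost)
qed

lemma points_cases:
  assumes z: "z \<in> points"
  obtains x where "x \<in> {a..b}" "z = base x" | l where "l \<in> B" "z = twin l"
proof -
  have ext: "z \<in> extensional index" and zc: "z c \<in> {a..b}"
    and z01: "\<And>i. i \<in> B \<Longrightarrow> z i \<in> {0, 1}" and zl: "\<And>l. l \<in> B \<Longrightarrow> z l = 0 \<or> z c = l"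
    using z c_notin by (force simp: points_def index_def PiE_def Pi_def split: if_splits)+
  show thesis
  proof (cases "z c \<in> B \<and> z (z c) = 1")
    case True
    have "z = twin (z c)"
      by (rule extensionalityI[OF ext])
        (use True z01 zl c_notin in \<open>auto simp: twin_def index_def\<close>)
    with True that(2) show thesis by blast
  next
    case False
    have "z = base (z c)"
      by (rule extensionalityI[OF ext])
        (use False z01 zl in \<open>force simp: base_def index_def\<close>)+
    with zc that(1) show thesis by blast
  qed
qed

lemma compact_K: "compact_space K"
proof -
  let ?P = "powertop_real index"
  let ?V = "\<lambda>i. if i = c then {a..b} else {0, 1::real}"
  have comp: "compactin ?P (PiE index ?V)"
    by (simp add: compactin_PiE)
  have "closedin ?P (PiE index ?V)"
    using comp by (rule compactin_imp_closedin[rotated]) (simp add: Hausdorff_space_product_topology)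
  \<comment> \<open>The disjunction in the definition of the space is the zero set of a product.\<close>
  moreover have "closedin ?P {z \<in> topspace ?P. z l * (z c - l) \<in> {0}}" if "l \<in> B" for l
  proof (rule closedin_continuous_map_preimage)
    show "continuous_map ?P euclideanreal (\<lambda>z. z l * (z c - l))"
      using that by (intro continuous_intros continuous_map_product_projection) (auto simp: index_def)
  qed simp
  ultimately have "closedin ?P (\<Inter>(insert (PiE index ?V)
      ((\<lambda>l. {z \<in> topspace ?P. z l * (z c - l) \<in> {0}}) ` B)))"
    by (intro closedin_Inter) auto
  also have "\<Inter>(insert (PiE index ?V) ((\<lambda>l. {z \<in> topspace ?P. z l * (z c - l) \<in> {0}}) ` B)) = points"
    by (auto simp: points_def PiE_def)
  finally have "closedin ?P points" .
  then have "compactin ?P points"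
    by (rule closed_compactin[OF comp, rotated]) (auto simp: points_def)
  then show ?thesis
    by (simp add: K_def compact_space_subtopology)
qed

lemma Hausdorff_K: "Hausdorff_space K"
  by (simp add: K_def Hausdorff_space_subtopology Hausdorff_space_product_topology)

text \<open>A point has at most two nonzero coordinates: \<open>c\<close> and its position.\<close>

lemma points_subset_c0: "points \<subseteq> c0 index"
proof
  fix z assume z: "z \<in> points"
  have "{i \<in> index. \<bar>z i\<bar> > \<epsilon>} \<subseteq> {c, z c}" if "\<epsilon> > 0" for \<epsilon>
    using z that by (force simp: points_def index_def)
  then have "finite {i \<in> index. \<bar>z i\<bar> > \<epsilon>}" if "\<epsilon> > 0" for \<epsilon>
    using that finite_subset by (metis finite.emptyI finite_insert)
  with z show "z \<in> c0 index"
    by (auto simp: c0_def points_def PiE_def)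
qed

lemma eberlein_compact_K: "eberlein_compact_space K"
proof (rule eberlein_compact_spaceI[OF compact_K])
  have "K = subtopology (subtopology (powertop_real index) (c0 index)) points"
    using points_subset_c0 by (simp add: K_def subtopology_subtopology Int_absorb1)
  then have "homeomorphic_map K (subtopology (subtopology (powertop_real index) (c0 index)) points) id"
    by simp
  moreover have "points \<subseteq> topspace (subtopology (powertop_real index) (c0 index))"
    using points_subset_c0 by (auto simp: c0_def)
  ultimately show "embedding_map K (subtopology (powertop_real index) (c0 index)) id"
    by (simp add: embedding_map_def Int_absorb1 Int_absorb2 del: topspace_subtopology)
qed

lemma continuous_map_K_coordinate:
  assumes "i \<in> index"
  shows "continuous_map K euclideanreal (\<lambda>z. z i)"
  unfolding K_def using assms
  by (intro continuous_map_from_subtopology continuous_map_product_projection)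

lemma continuous_map_base: "continuous_map (top_of_set {a..b}) K base"
  unfolding K_def continuous_map_in_subtopology continuous_map_componentwise
proof (intro conjI ballI)
  show "base \<in> topspace (top_of_set {a..b}) \<rightarrow> points"
    using base_in_points by simp
  show "base ` topspace (top_of_set {a..b}) \<subseteq> extensional index"
    by (auto simp: base_def)
  fix i assume "i \<in> index"
  then show "continuous_map (top_of_set {a..b}) euclideanreal (\<lambda>x. base x i)"
    by (cases "i = c") (simp_all add: base_def)
qed

text \<open>As \<open>l\<close> approaches \<open>x\<close> without being equal to it, \<open>l\<close> eventually differs from each fixed
  index, so each flag of \<open>twin l\<close> tends to \<open>0\<close>.\<close>

lemma base_mem_if_limit_of_twins:
  assumes F: "closedin K F" and x: "x islimpt {l \<in> B. twin l \<in> F}"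
  shows "base x \<in> F"
proof -
  let ?A = "{l \<in> B. twin l \<in> F}"
  let ?N = "at x within ?A"
  have xab: "x \<in> {a..b}"
    by (rule limpt_in_interval[OF x]) auto
  have evA: "\<forall>\<^sub>F l in ?N. l \<in> ?A"
    by (simp add: eventually_at_filter)
  have "limitin K twin (base x) ?N"
    unfolding K_def limitin_subtopology limitin_componentwise
  proof (intro conjI ballI)
    show "base x \<in> points" "base x \<in> extensional index"
      using base_in_points[OF xab] by (auto simp: base_def)
    show "\<forall>\<^sub>F l in ?N. twin l \<in> points"
      using evA by eventually_elim (simp add: twin_in_points)
    show "\<forall>\<^sub>F l in ?N. twin l \<in> topspace (powertop_real index)"
      by (simp add: twin_def)
    fix i assume i: "i \<in> index"
    show "limitin euclideanreal (\<lambda>l. twin l i) (base x i) ?N"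
    proof (cases "i = c")
      case True
      then show ?thesis using i by (simp add: twin_def base_def)
    next
      case False
      have "\<forall>\<^sub>F l in ?N. l \<noteq> i"
        by (rule eventually_neq_at_within)
      then have "\<forall>\<^sub>F l in ?N. twin l i = base x i"
        by eventually_elim (use False in \<open>auto simp: twin_def base_def\<close>)
      then show ?thesis
        by (simp add: tendsto_eventually)
    qed
  qed
  moreover have "\<forall>\<^sub>F l in ?N. twin l \<in> F"
    using evA by eventually_elim simp
  moreover have "\<not> trivial_limit ?N"
    using x by (simp add: trivial_limit_within)
  ultimately show ?thesis
    by (rule limitin_closedin[OF _ F])
qed

section \<open>Metrizability and twins\<close>

lemma not_metrizable_duplicate:
  assumes "uncountable B"
  shows "\<not> metrizable_space K"
proof
  assume met: "metrizable_space K"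
  have "compactin K (base ` {a..b})"
    by (rule image_compactin[OF _ continuous_map_base]) (simp add: compactin_subtopology)
  then have "closedin K (base ` {a..b})"
    using Hausdorff_K compactin_imp_closedin by blast
  then have "fsigma_in K (topspace K - base ` {a..b})"
    using met open_imp_fsigma_in by blast
  then obtain C :: "nat \<Rightarrow> _" where C: "\<And>n. closedin K (C n)"
    and CU: "(\<Union>n. C n) = points - base ` {a..b}"
    by (auto simp: fsigma_in_ascending)
  have "finite {l \<in> B. twin l \<in> C n}" for n
  proof (rule ccontr)
    assume "infinite {l \<in> B. twin l \<in> C n}"
    moreover have "bounded {l \<in> B. twin l \<in> C n}"
      by (rule bounded_subset[of "{a..b}"]) (use B_subset in auto)
    ultimately obtain x where x: "x islimpt {l \<in> B. twin l \<in> C n}"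
      using bounded_infinite_imp_islimpt by blast
    then have "x \<in> {a..b}"
      by (rule limpt_in_interval) auto
    moreover have "base x \<in> C n"
      using base_mem_if_limit_of_twins[OF C x] .
    moreover have "base x \<notin> C n" if "x \<in> {a..b}"
      using CU that by (metis DiffE UN_I UNIV_I imageI)
    ultimately show False by simp
  qed
  then have "countable (\<Union>n. {l \<in> B. twin l \<in> C n})"
    by (intro countable_UN) (auto intro: countable_finite)
  moreover have "B \<subseteq> (\<Union>n. {l \<in> B. twin l \<in> C n})"
  proof
    fix l assume l: "l \<in> B"
    have "twin l \<notin> base ` {a..b}"
      using twin_flag[OF l] base_flag[OF l] by fastforce
    then have "twin l \<in> (\<Union>n. C n)"
      using CU twin_in_points[OF l] by simp
    with l show "l \<in> (\<Union>n. {l \<in> B. twin l \<in> C n})" by simp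
  qed
  ultimately have "countable B"
    by (rule countable_subset[rotated])
  with assms show False by simp
qed

text \<open>The position together with the flags of the twins present in \<open>F\<close> separates the points of
  \<open>F\<close>, so these countably many coordinates embed the compact space \<open>F\<close> in a metrizable product.\<close>

lemma metrizable_if_few_twins:
  assumes F: "closedin K F" and count: "countable {l \<in> B. twin l \<in> F}"
  shows "metrizable_space (subtopology K F)"
proof -
  define D where "D = insert c {l \<in> B. twin l \<in> F}"
  have FS: "F \<subseteq> points" using closedin_subset[OF F] by simp
  have top: "topspace (subtopology K F) = F" using FS by auto
  have comp: "compact_space (subtopology K F)"
    using F compact_K closedin_compact_space compact_space_subtopology by blast
  have "countable D" using count by (simp add: D_def)
  then have met: "metrizable_space (powertop_real D)"
    by (simp add: metrizable_space_product_topology metrizable_space_euclidean)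
  have cont: "continuous_map (subtopology K F) (powertop_real D) (\<lambda>z. restrict z D)"
    unfolding continuous_map_componentwise
  proof (intro conjI ballI)
    show "(\<lambda>z. restrict z D) ` topspace (subtopology K F) \<subseteq> extensional D"
      by auto
    fix i assume i: "i \<in> D"
    then have "i \<in> index" by (auto simp: D_def index_def)
    then have "continuous_map (subtopology K F) euclideanreal (\<lambda>z. z i)"
      by (intro continuous_map_from_subtopology continuous_map_K_coordinate)
    then show "continuous_map (subtopology K F) euclideanreal (\<lambda>z. restrict z D i)"
      using i by simp
  qed
  have inj: "inj_on (\<lambda>z. restrict z D) F"
  proof (rule inj_onI)
    fix z w assume z: "z \<in> F" and w: "w \<in> F" and eq: "restrict z D = restrict w D"
    have agree: "z i = w i" if "i \<in> D" for i
      using fun_cong[OF eq, of i] that by simp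
    have c: "z c = w c" using agree by (simp add: D_def)
    have no_flag: "base x \<notin> {z, w}" if "twin l \<in> {z, w}" "l \<in> B" for x l
    proof
      assume "base x \<in> {z, w}"
      moreover have "z l = w l" using agree that z w by (auto simp: D_def)
      ultimately show False
        using that twin_flag[OF that(2)] base_flag[OF that(2), of x] by auto
    qed
    have "z \<in> points" "w \<in> points" using z w FS by auto
    then show "z = w"
      using no_flag c by (elim points_cases) auto
  qed
  have "embedding_map (subtopology K F) (powertop_real D) (\<lambda>z. restrict z D)"
    using cont inj comp
    by (intro injective_closed_imp_embedding_map continuous_imp_closed_map)
      (auto simp: top Hausdorff_space_product_topology simp del: topspace_subtopology)
  then show ?thesis
    using met embedding_map_imp_homeomorphic_space homeomorphic_metrizable_space
      metrizable_space_subtopology by blast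
qed

section \<open>Intervals in a closed subspace\<close>

lemma not_zero_dimensional_if_interval:
  assumes F: "F \<subseteq> points" and uv: "u < v" "{u..v} \<subseteq> {a..b}" "base ` {u..v} \<subseteq> F"
  shows "\<not> zero_dimensional_space (subtopology K F)"
proof
  assume "zero_dimensional_space (subtopology K F)"
  then obtain \<B> where clopen: "\<And>V. V \<in> \<B> \<Longrightarrow> openin (subtopology K F) V \<and> closedin (subtopology K F) V"
    and gen: "\<And>U. openin (subtopology K F) U \<Longrightarrow> \<exists>\<U>\<subseteq>\<B>. U = \<Union>\<U>"
    unfolding zero_dimensional_space_def by auto
  have "connectedin (top_of_set {a..b}) {u..v}"
    using uv by (simp add: connectedin_subtopology)
  then have "connectedin K (base ` {u..v})"
    by (rule connectedin_continuous_map_image[OF continuous_map_base])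
  then have conn: "connectedin (subtopology K F) (base ` {u..v})"
    using uv by (simp add: connectedin_subtopology)
  have ends: "base u \<in> F" "base v \<in> F" "base u \<noteq> base v"
    using uv base_at_c by (force, force, metis less_irrefl)
  have "t1_space (subtopology K F)"
    using Hausdorff_K Hausdorff_imp_t1_space t1_space_subtopology by blast
  then have "closedin (subtopology K F) {base v}"
    using ends F by (auto simp: t1_space_closedin_singleton)
  then have "openin (subtopology K F) (topspace (subtopology K F) - {base v})"
    by blast
  then obtain \<U> where "\<U> \<subseteq> \<B>" "topspace (subtopology K F) - {base v} = \<Union>\<U>"
    using gen by blast
  moreover have "base u \<in> topspace (subtopology K F) - {base v}"
    using ends F by auto
  ultimately obtain V where V: "V \<in> \<B>" "base u \<in> V" "base v \<notin> V"
    by blast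
  then have "base ` {u..v} \<subseteq> V \<or> disjnt (base ` {u..v}) V"
    using connectedin_clopen_cases[OF conn] clopen by blast
  moreover have "base u \<in> base ` {u..v}" "base v \<in> base ` {u..v}"
    using uv(1) by auto
  ultimately show False
    using V by (auto simp: disjnt_iff)
qed

text \<open>The parameters of the twins in a nonmetrizable \<open>F\<close> accumulate at every point of some
  interval.\<close>

lemma closed_nonmetrizable_not_zero_dimensional:
  assumes L: "luzin_set L" "B \<subseteq> L"
    and F: "closedin K F" "\<not> metrizable_space (subtopology K F)"
  shows "\<not> zero_dimensional_space (subtopology K F)"
proof -
  have "uncountable {l \<in> B. twin l \<in> F}"
    using F metrizable_if_few_twins by blast
  then obtain u v where uv: "u < v" "\<And>x. x \<in> {u..v} \<Longrightarrow> x islimpt {l \<in> B. twin l \<in> F}"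
    by (rule luzin_set_uncountable_subset_limpt[OF L(1), rotated]) (use L(2) in auto)
  show ?thesis
  proof (rule not_zero_dimensional_if_interval[OF _ uv(1)])
    show FS: "F \<subseteq> points" using closedin_subset[OF F(1)] by simp
    show "base ` {u..v} \<subseteq> F"
      using base_mem_if_limit_of_twins[OF F(1)] uv(2) by blast
    show "{u..v} \<subseteq> {a..b}"
      using limpt_in_interval[OF uv(2)] by blast
  qed
qed

end

section \<open>The example\<close>

theorem corollary4p8:
  assumes "\<exists>L. luzin_set L"
  shows "\<exists>K :: (real \<Rightarrow> real) topology.
    eberlein_compact_space K \<and> \<not> metrizable_space K \<and>
    \<not> (\<exists>F. closedin K F \<and> \<not> metrizable_space (subtopology K F) \<and>
           zero_dimensional_space (subtopology K F))"
proof -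
  obtain L where L: "luzin_set L" using assms by blast
  then obtain a b where unc: "uncountable (L \<inter> {a..b})"
    by (rule luzin_set_bounded_part)
  \<comment> \<open>The position index \<open>b + 1\<close> is chosen outside the interval, so that it is not a flag.\<close>
  interpret duplicate a b "b + 1" "L \<inter> {a..b}"
    by unfold_locales auto
  show ?thesis
    using eberlein_compact_K not_metrizable_duplicate[OF unc]
      closed_nonmetrizable_not_zero_dimensional[OF L Int_lower1] by blast
qed

end
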